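(* For every real $\nu$ with $\nu\in\left(0,\frac{1}{2}\right]$ the following holds: if $G$ is a graph of order $n$, size $m$, and matching number $\nu n$ such that $\left(\frac{\nu}{50}\right)^2 n\geq 1$ and $m\geq m(n,\nu)-\left(\frac{\nu}{50}\right)^2 n^2$, then $G$ has at least $\lceil 0.1n\rceil^{\underline{\lceil 0.1\nu n\rceil}}$ maximum matchings.
   Context: Graphs are finite, simple and undirected. The matching number $\nu(G)$ is the largest size of a matching in $G$; a maximum matching is a matching of size $\nu(G)$. For an integer $n\ge 1$ and a real $\nu\in[0,\frac12]$ with $\nu n$ an integer, define $m(n,\nu)=\nu n(n-\nu n)+\binom{\nu n}{2}$ if $\nu\leq \frac{2}{5}-\frac{3}{5n}$, and $m(n,\nu)=\binom{2\nu n+1}{2}$ if $\frac{2}{5}-\frac{3}{5n}\leq \nu\leq\frac12$ (this is the Erdős–Gallai bound on the size of a graph of order $n$ with matching number $\nu n$). For positive integers $N\ge K$, the falling factorial is $N^{\underline{K}}=N(N-1)\cdots(N-K+1)$. *)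

theory Defs
  imports Complex_Main
begin

definition simple_graph :: "'a set \<Rightarrow> 'a set set \<Rightarrow> bool" where
  "simple_graph V E \<longleftrightarrow> finite V \<and> (\<forall>e\<in>E. e \<subseteq> V \<and> card e = 2)"

definition matching :: "'a set set \<Rightarrow> 'a set set \<Rightarrow> bool" where
  "matching E M \<longleftrightarrow> M \<subseteq> E \<and> pairwise disjnt M"

definition matching_number :: "'a set set \<Rightarrow> nat" where
  "matching_number E = Max (card ` {M. matching E M})"

definition maximum_matching :: "'a set set \<Rightarrow> 'a set set \<Rightarrow> bool" where
  "maximum_matching E M \<longleftrightarrow> matching E M \<and> card M = matching_number E"

text \<open>
  The Erdos--Gallai bound, used only when \<open>\<nu> * n\<close> is a natural number, where \<open>gchoose\<close> is the
  ordinary binomial coefficient. For \<open>\<nu> = 2/5 - 3/(5*n)\<close> the two expressions coincide.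
\<close>

definition erdos_gallai_bound :: "nat \<Rightarrow> real \<Rightarrow> real" where
  "erdos_gallai_bound n \<nu> =
    (if \<nu> \<le> 2/5 - 3 / (5 * real n)
     then \<nu> * real n * (real n - \<nu> * real n) + ((\<nu> * real n) gchoose 2)
     else (2 * \<nu> * real n + 1) gchoose 2)"

text \<open>Intended for \<open>K \<le> N\<close>, where the subtraction does not truncate.\<close>

definition falling_factorial :: "nat \<Rightarrow> nat \<Rightarrow> nat" where
  "falling_factorial N K = (\<Prod>i<K. N - i)"

end

(* Let M be a maximum matching and U the independent set of vertices it misses. The edges of M can
be oriented, e = {a e, b e}, so that at least half of the edges of G run from a-ends to b-ends or U.
Repeatedly discarding an edge e whose a-end sees fewer than N = ceil(n/10) of the remaining b-ends
and of U destroys too few edges to exhaust M, so it stops at a subset I of M with at least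
K = ceil(k/10) edges, where k = |M|. By Marshall Hall's theorem there are at least
N(N-1)...(N-K+1) ways to match the a-ends of I into the b-ends of I and U, and each of them,
together with M - I, is a maximum matching. Since half of the Erdos-Gallai bound exceeds the
number of edges the process can lose, no stability analysis of the extremal graphs is needed. *)

theory Submission
  imports Defs "HOL-Library.FuncSet"
begin

section \<open>Falling factorials and systems of distinct representatives\<close>

lemma falling_factorial_Suc: "falling_factorial (Suc N) (Suc K) = Suc N * falling_factorial N K"
  unfolding falling_factorial_def by (subst prod.lessThan_Suc_shift) simp

lemma falling_factorial_mono:
  assumes "K \<le> K'" "K' \<le> N"
  shows "falling_factorial N K \<le> falling_factorial N K'"
proof -
  have "falling_factorial N K' = falling_factorial N K * (\<Prod>i\<in>{K..<K'}. N - i)"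
    unfolding falling_factorial_def
    using assms prod.union_disjoint[of "{..<K}" "{K..<K'}" "\<lambda>i. N - i"]
    by (simp add: ivl_disj_un ivl_disj_int)
  moreover have "(\<Prod>i\<in>{K..<K'}. N - i) \<ge> 1"
    using assms by (intro prod_ge_1) auto
  ultimately show ?thesis by simp
qed

text \<open>Systems of distinct representatives of the family \<open>S\<close>. \<open>PiE\<close>
  fixes the value \<open>undefined\<close> off \<open>X\<close>, so that each system is counted
  once.\<close>

definition transversals :: "'i set \<Rightarrow> ('i \<Rightarrow> 'b set) \<Rightarrow> ('i \<Rightarrow> 'b) set" where
  "transversals X S = {f \<in> PiE X S. inj_on f X}"

lemma finite_transversals:
  assumes "finite X" "\<And>x. x \<in> X \<Longrightarrow> finite (S x)"
  shows "finite (transversals X S)"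
  unfolding transversals_def using finite_PiE[of X S] assms by simp

text \<open>A value \<open>w\<close> at \<open>x\<close> and a transversal of the rest avoiding
  \<open>w\<close> combine to a transversal of the whole family, and the pair can be read off from
  the result.\<close>

lemma transversals_insert:
  assumes "finite X" "x \<in> X" "\<And>y. y \<in> X \<Longrightarrow> finite (S y)"
  shows "(\<Sum>w\<in>S x. card (transversals (X - {x}) (\<lambda>y. S y - {w}))) \<le> card (transversals X S)"
proof -
  define D where "D = (SIGMA w:S x. transversals (X - {x}) (\<lambda>y. S y - {w}))"
  define ext where "ext = (\<lambda>(w, f). f(x := w) :: 'a \<Rightarrow> 'b)"
  have "inj_on ext D"
  proof (rule inj_onI, clarify)
    fix w f w' f'
    assume "(w, f) \<in> D" "(w', f') \<in> D" and eq: "ext (w, f) = ext (w', f')"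
    \<comment> \<open>Both functions have the default value at \<open>x\<close>, so overwriting it
      loses no information.\<close>
    then have "f x = undefined" "f' x = undefined"
      by (auto simp: D_def transversals_def)
    then have "f y = f' y" for y
      using fun_cong[OF eq, of y] by (cases "y = x") (auto simp: ext_def)
    moreover have "w = w'"
      using fun_cong[OF eq, of x] by (simp add: ext_def)
    ultimately show "w = w' \<and> f = f'" by auto
  qed
  moreover have "ext ` D \<subseteq> transversals X S"
  proof clarify
    fix w f assume "(w, f) \<in> D"
    then have w: "w \<in> S x" and f: "f \<in> PiE (X - {x}) (\<lambda>y. S y - {w})" "inj_on f (X - {x})"
      by (auto simp: D_def transversals_def)
    have "f(x := w) \<in> PiE X S"
      using f(1) w assms(2) by (auto simp: PiE_iff extensional_def)
    moreover have "inj_on (f(x := w)) X"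
      using f unfolding inj_on_def PiE_iff by auto
    ultimately show "ext (w, f) \<in> transversals X S"
      by (simp add: ext_def transversals_def)
  qed
  ultimately have "card D \<le> card (transversals X S)"
    using card_inj_on_le finite_transversals[of X S] assms by blast
  then show ?thesis
    unfolding D_def using assms by (subst (asm) card_SigmaI) (auto intro!: finite_transversals)
qed

text \<open>Representatives of \<open>Y\<close> come from the union of its own sets. Once that union
  is removed from the other sets, the two halves can be chosen independently.\<close>

lemma transversals_union:
  assumes "finite X" "Y \<subseteq> X" "\<And>y. y \<in> X \<Longrightarrow> finite (S y)"
  shows "card (transversals Y S) * card (transversals (X - Y) (\<lambda>x. S x - \<Union>(S ` Y)))
    \<le> card (transversals X S)"
proof -
  let ?R = "transversals (X - Y) (\<lambda>x. S x - \<Union>(S ` Y))"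
  define glue where "glue = (\<lambda>(g, h) x. if x \<in> Y then g x else h x :: 'b)"
  have "inj_on glue (transversals Y S \<times> ?R)"
  proof (rule inj_onI, clarify)
    fix g h g' h'
    assume gh: "g \<in> transversals Y S" "h \<in> ?R" "g' \<in> transversals Y S" "h' \<in> ?R"
      and eq: "glue (g, h) = glue (g', h')"
    have "g x = g' x \<and> h x = h' x" for x
      using fun_cong[OF eq, of x] gh
      by (cases "x \<in> Y") (auto simp: glue_def transversals_def PiE_iff extensional_def)
    then show "g = g' \<and> h = h'" by auto
  qed
  moreover have "glue ` (transversals Y S \<times> ?R) \<subseteq> transversals X S"
  proof clarify
    fix g h assume g: "g \<in> transversals Y S" and h: "h \<in> ?R"
    have gS: "g x \<in> S x" if "x \<in> Y" for x
      using g that by (auto simp: transversals_def)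
    have hS: "h x \<in> S x - \<Union>(S ` Y)" if "x \<in> X - Y" for x
      using h that unfolding transversals_def by blast
    have "glue (g, h) \<in> PiE X S"
      using gS hS h assms(2) by (auto simp: glue_def transversals_def PiE_iff extensional_def)
    moreover have "inj_on (glue (g, h)) X"
    proof (rule inj_onI)
      fix x y assume xy: "x \<in> X" "y \<in> X" "glue (g, h) x = glue (g, h) y"
      have "inj_on g Y" "inj_on h (X - Y)"
        using g h by (auto simp: transversals_def)
      then show "x = y"
        using xy gS[of x] gS[of y] hS[of x] hS[of y]
        by (auto simp: glue_def split: if_splits dest: inj_onD)
    qed
    ultimately show "glue (g, h) \<in> transversals X S"
      by (simp add: transversals_def)
  qed
  ultimately have "card (transversals Y S \<times> ?R) \<le> card (transversals X S)"
    using card_inj_on_le finite_transversals[of X S] assms by blast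
  then show ?thesis by (simp add: card_cartesian_product)
qed

text \<open>Marshall Hall's strengthening of the marriage theorem; the case \<open>d = 0\<close> is the marriage
  theorem itself, which the induction needs when it removes a tight subfamily.\<close>

theorem card_transversals_ge:
  assumes "finite X" "\<And>x. x \<in> X \<Longrightarrow> finite (S x)" "\<And>x. x \<in> X \<Longrightarrow> d \<le> card (S x)"
    and "\<And>Y. Y \<subseteq> X \<Longrightarrow> card Y \<le> card (\<Union>(S ` Y))"
  shows "falling_factorial d (min d (card X)) \<le> card (transversals X S)"
  using assms
proof (induction "card X" arbitrary: X S d rule: less_induct)
  case less
  note fin = less.prems(1,2) and deg = less.prems(3) and hall = less.prems(4)
  show ?case
  proof (cases "X = {}")
    case True
    then show ?thesis by (simp add: transversals_def falling_factorial_def inj_on_def)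
  next
    case ne: False
    show ?thesis
    \<comment> \<open>If Hall's condition is tight on a proper subfamily \<open>Y\<close>, fixing a
      representative elsewhere could break it, so the family is split at \<open>Y\<close>. Otherwise
      a single representative can be fixed arbitrarily.\<close>
    proof (cases "\<exists>Y. Y \<subset> X \<and> Y \<noteq> {} \<and> card (\<Union>(S ` Y)) = card Y")
      case True
      then obtain Y where Y: "Y \<subset> X" "Y \<noteq> {}" "card (\<Union>(S ` Y)) = card Y" by blast
      have finY: "finite Y" using Y(1) fin(1) finite_subset by blast
      have finU: "finite (\<Union>(S ` Y))" using Y(1) fin finY by auto
      have cY: "card Y < card X" using Y(1) fin(1) by (simp add: psubset_card_mono)
      have cXY: "card (X - Y) < card X"
        using Y(1,2) fin(1) by (intro psubset_card_mono) auto
      obtain y where y: "y \<in> Y" using Y(2) by blast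
      \<comment> \<open>Tightness makes \<open>Y\<close> at least as large as one of its sets, so
        the transversals of \<open>Y\<close> alone already reach the full bound and one completion
        suffices.\<close>
      have "d \<le> card (S y)" using deg y Y(1) by blast
      also have "\<dots> \<le> card Y" unfolding Y(3)[symmetric] using y finU by (intro card_mono) auto
      finally have dY: "d \<le> card Y" .
      have "falling_factorial d (min d (card Y)) \<le> card (transversals Y S)"
        using Y(1) by (intro less.hyps[OF cY finY]) (auto intro!: fin deg hall)
      moreover have "falling_factorial 0 (min 0 (card (X - Y)))
          \<le> card (transversals (X - Y) (\<lambda>x. S x - \<Union>(S ` Y)))"
      proof (rule less.hyps[OF cXY])
        fix Z assume Z: "Z \<subseteq> X - Y"
        have finZ: "finite Z" using Z fin(1) finite_subset by blast
        \<comment> \<open>Hall's condition for \<open>Z\<close> and \<open>Y\<close> together, less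
          the equality for \<open>Y\<close>, is Hall's condition for \<open>Z\<close> in the reduced
          family.\<close>
        have "card Z + card Y = card (Z \<union> Y)"
          using Z finZ finY by (subst card_Un_disjoint) auto
        also have "\<dots> \<le> card (\<Union>(S ` (Z \<union> Y)))"
          using Z Y(1) by (intro hall) auto
        also have "\<Union>(S ` (Z \<union> Y)) = (\<Union>x\<in>Z. S x - \<Union>(S ` Y)) \<union> \<Union>(S ` Y)"
          by auto
        also have "card \<dots> \<le> card (\<Union>x\<in>Z. S x - \<Union>(S ` Y)) + card Y"
          unfolding Y(3)[symmetric] by (rule card_Un_le)
        finally show "card Z \<le> card (\<Union>x\<in>Z. S x - \<Union>(S ` Y))" by simp
      qed (use fin in auto)
      ultimately have "falling_factorial d d * 1
          \<le> card (transversals Y S) * card (transversals (X - Y) (\<lambda>x. S x - \<Union>(S ` Y)))"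
        using dY by (intro mult_mono) (auto simp: falling_factorial_def)
      also have "\<dots> \<le> card (transversals X S)"
        using Y(1) fin by (intro transversals_union) auto
      finally show ?thesis using dY cY by (simp add: min_def)
    next
      case False
      have strict: "card Y < card (\<Union>(S ` Y))" if "Y \<subset> X" "Y \<noteq> {}" for Y
        using False hall[of Y] that by (metis le_neq_implies_less psubset_imp_subset)
      obtain x where x: "x \<in> X" using ne by blast
      have cX: "card X = Suc (card (X - {x}))"
        using fin(1) x by (rule card.remove)
      \<comment> \<open>The slack of one in \<open>strict\<close> pays for deleting
        \<open>w\<close>, so Hall's condition survives every choice of \<open>w\<close>, and the
        degrees drop by at most one.\<close>
      have IH: "falling_factorial (d - 1) (min (d - 1) (card (X - {x})))
          \<le> card (transversals (X - {x}) (\<lambda>y. S y - {w}))" for w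
      proof (rule less.hyps)
        fix y assume "y \<in> X - {x}"
        then show "d - 1 \<le> card (S y - {w})"
          using deg[of y] by (auto simp: card_Diff_singleton_if)
      next
        fix Y assume Y: "Y \<subseteq> X - {x}"
        show "card Y \<le> card (\<Union>y\<in>Y. S y - {w})"
        proof (cases "Y = {}")
          case False
          have "card Y < card (\<Union>(S ` Y))" using strict[of Y] Y x False by blast
          moreover have "(\<Union>y\<in>Y. S y - {w}) = \<Union>(S ` Y) - {w}" by auto
          ultimately show ?thesis by (auto simp: card_Diff_singleton_if)
        qed simp
      qed (use fin cX in auto)
      \<comment> \<open>Covers \<open>d = 0\<close>, where \<open>d - 1\<close> truncates and both
        falling factorials are 1.\<close>
      have pos: "1 \<le> card (S x)" using hall[of "{x}"] x by simp
      have "falling_factorial d (min d (card X))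
          \<le> card (S x) * falling_factorial (d - 1) (min (d - 1) (card (X - {x})))"
      proof (cases d)
        case 0
        then show ?thesis using pos by (simp add: falling_factorial_def)
      next
        case (Suc c)
        then show ?thesis
          using mult_right_mono[OF deg[OF x]] by (simp add: cX falling_factorial_Suc del: mult_Suc)
      qed
      also have "\<dots> \<le> (\<Sum>w\<in>S x. card (transversals (X - {x}) (\<lambda>y. S y - {w})))"
        using sum_mono[OF IH, of "S x"] by simp
      also have "\<dots> \<le> card (transversals X S)"
        using fin x by (intro transversals_insert) auto
      finally show ?thesis .
    qed
  qed
qed

section \<open>Orienting the matching and extracting a dense core\<close>

text \<open>Under a uniformly random orientation the right side has expectation at least the left
  side: equality for \<open>h\<close> and off the diagonal, a gain on the diagonal. The induction
  orients one pair at a time by averaging. In use, \<open>q\<close> is adjacency and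
  \<open>h\<close> counts unmatched neighbours, so the left side is twice the number of
  edges.\<close>

lemma exists_orientation:
  fixes q :: "'a \<Rightarrow> 'a \<Rightarrow> nat"
  assumes "finite J" and sym: "\<And>x y. q x y = q y x" and irrefl: "\<And>x. q x x = 0"
  shows "\<exists>a b. (\<forall>i\<in>J. (a i = s i \<and> b i = t i) \<or> (a i = t i \<and> b i = s i)) \<and>
    (\<Sum>i\<in>J. \<Sum>j\<in>J. q (s i) (s j) + q (s i) (t j) + q (t i) (s j) + q (t i) (t j))
      + 2 * (\<Sum>i\<in>J. h (s i) + h (t i))
    \<le> 4 * (\<Sum>i\<in>J. (\<Sum>j\<in>J. q (a i) (b j)) + h (a i))"
  using assms(1)
proof (induction J)
  case (insert p J)
  then obtain a b where ab: "\<forall>i\<in>J. (a i = s i \<and> b i = t i) \<or> (a i = t i \<and> b i = s i)"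
    and le: "(\<Sum>i\<in>J. \<Sum>j\<in>J. q (s i) (s j) + q (s i) (t j) + q (t i) (s j) + q (t i) (t j))
      + 2 * (\<Sum>i\<in>J. h (s i) + h (t i)) \<le> 4 * (\<Sum>i\<in>J. (\<Sum>j\<in>J. q (a i) (b j)) + h (a i))"
    by blast
  \<comment> \<open>Both ends of an old pair occur whichever way it is oriented.\<close>
  have same: "(\<Sum>i\<in>J. q x (s i)) + (\<Sum>i\<in>J. q x (t i)) = (\<Sum>i\<in>J. q x (a i)) + (\<Sum>i\<in>J. q x (b i))" for x
    unfolding sum.distrib[symmetric] using ab by (intro sum.cong) auto
  have new: "(\<Sum>i\<in>insert p J. (\<Sum>j\<in>insert p J. q ((a(p := x)) i) ((b(p := y)) j)) + h ((a(p := x)) i))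
      = (\<Sum>i\<in>J. (\<Sum>j\<in>J. q (a i) (b j)) + h (a i))
        + (\<Sum>i\<in>J. q y (a i)) + (\<Sum>i\<in>J. q x (b i)) + q x y + h x" (is "?new x y = _") for x y
  proof -
    have "a(p := x) = (\<lambda>i. if i = p then x else a i)" "b(p := y) = (\<lambda>i. if i = p then y else b i)"
      by auto
    moreover have "(\<Sum>i\<in>J. (\<Sum>j\<in>insert p J. q ((a(p := x)) i) ((b(p := y)) j)) + h ((a(p := x)) i))
      = (\<Sum>i\<in>J. ((\<Sum>j\<in>J. q (a i) (b j)) + h (a i)) + q y (a i))"
    proof (rule sum.cong)
      fix i assume "i \<in> J"
      then have "i \<noteq> p" using insert.hyps by blast
      moreover have "(\<Sum>j\<in>J. q (a i) ((b(p := y)) j)) = (\<Sum>j\<in>J. q (a i) (b j))"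
        using insert.hyps by (intro sum.cong) auto
      ultimately show "(\<Sum>j\<in>insert p J. q ((a(p := x)) i) ((b(p := y)) j)) + h ((a(p := x)) i)
        = ((\<Sum>j\<in>J. q (a i) (b j)) + h (a i)) + q y (a i)"
        using insert.hyps by (simp add: sym[of "a i" y])
    qed simp
    moreover have "(\<Sum>j\<in>J. q x ((b(p := y)) j)) = (\<Sum>j\<in>J. q x (b j))"
      using insert.hyps by (intro sum.cong) auto
    ultimately show ?thesis
      using insert.hyps by (simp add: sum.distrib del: fun_upd_apply)
  qed
  \<comment> \<open>Over the two orientations of \<open>p\<close>, each end of \<open>p\<close>
    meets all a-ends once and all b-ends once, which by \<open>same\<close> covers both ends of
    every old pair.\<close>
  have "(\<Sum>i\<in>insert p J. \<Sum>j\<in>insert p J. q (s i) (s j) + q (s i) (t j) + q (t i) (s j) + q (t i) (t j))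
      + 2 * (\<Sum>i\<in>insert p J. h (s i) + h (t i))
    \<le> 2 * (?new (s p) (t p) + ?new (t p) (s p))"
  proof -
    have "(\<Sum>i\<in>J. q (s i) x) = (\<Sum>i\<in>J. q x (s i))" "(\<Sum>i\<in>J. q (t i) x) = (\<Sum>i\<in>J. q x (t i))" for x
      by (simp_all only: sym[of _ x])
    then show ?thesis
      unfolding new using le same[of "s p"] same[of "t p"] insert.hyps sym[of "t p" "s p"]
      by (simp add: sum.distrib irrefl)
  qed
  \<comment> \<open>Hence one of the two orientations is at least as good as their average.\<close>
  moreover have "x \<le> 4 * u \<or> x \<le> 4 * v" if "x \<le> 2 * (u + v)" for x u v :: nat
    using that by arith
  ultimately have "\<exists>(x, y)\<in>{(s p, t p), (t p, s p)}.
    (\<Sum>i\<in>insert p J. \<Sum>j\<in>insert p J. q (s i) (s j) + q (s i) (t j) + q (t i) (s j) + q (t i) (t j))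
      + 2 * (\<Sum>i\<in>insert p J. h (s i) + h (t i)) \<le> 4 * ?new x y"
    by (simp only: bex_simps case_prod_conv simp_thms)
  then obtain x y where xy: "(x, y) \<in> {(s p, t p), (t p, s p)}"
    and "(\<Sum>i\<in>insert p J. \<Sum>j\<in>insert p J. q (s i) (s j) + q (s i) (t j) + q (t i) (s j) + q (t i) (t j))
      + 2 * (\<Sum>i\<in>insert p J. h (s i) + h (t i)) \<le> 4 * ?new x y"
    by blast
  moreover have "\<forall>i\<in>insert p J. ((a(p := x)) i = s i \<and> (b(p := y)) i = t i)
      \<or> ((a(p := x)) i = t i \<and> (b(p := y)) i = s i)"
    using ab xy by auto
  ultimately show ?case by blast
qed simp

text \<open>Indices \<open>p\<close> of weight below \<open>N\<close> are deleted one by one. A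
  deletion loses less than \<open>N\<close> from the row of \<open>p\<close> and at most one per
  remaining index from its column, which the decrease of
  \<open>2 * card J * N + (card J)\<^sup>2\<close> covers. Fewer than \<open>K\<close> indices carry
  total weight at most \<open>K * (K + u)\<close>, so the inequality would fail before
  \<open>J\<close> became that small.\<close>

lemma exists_dense_core:
  fixes r :: "'i \<Rightarrow> 'i \<Rightarrow> nat" and h :: "'i \<Rightarrow> nat"
  assumes "finite J" and r: "\<And>i j. r i j \<le> 1" and h: "\<And>i. i \<in> J \<Longrightarrow> h i \<le> u"
    and "2 * K * (K + u) + 2 * card J * N + (card J)\<^sup>2
      < 2 * (\<Sum>i\<in>J. (\<Sum>j\<in>J. r i j) + h i)"
  shows "\<exists>I\<subseteq>J. K \<le> card I \<and> (\<forall>i\<in>I. N \<le> (\<Sum>j\<in>I. r i j) + h i)"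
  using assms(1,3,4)
proof (induction "card J" arbitrary: J rule: less_induct)
  case less
  note fin = less.prems(1)
  show ?case
  proof (cases "K \<le> card J \<and> (\<forall>i\<in>J. N \<le> (\<Sum>j\<in>J. r i j) + h i)")
    case False
    have "K \<le> card J"
    proof (rule ccontr)
      assume "\<not> K \<le> card J"
      have "(\<Sum>j\<in>J. r i j) \<le> card J" for i
        using sum_mono[of J "r i" "\<lambda>_. 1"] r by simp
      then have "(\<Sum>i\<in>J. (\<Sum>j\<in>J. r i j) + h i) \<le> (\<Sum>i\<in>J. card J + u)"
        using less.prems(2) by (intro sum_mono add_mono) auto
      also have "\<dots> \<le> K * (K + u)"
        using \<open>\<not> K \<le> card J\<close> by (auto intro!: mult_mono)
      finally show False using less.prems(3) by simp
    qed
    then obtain p where p: "p \<in> J" "(\<Sum>j\<in>J. r p j) + h p < N"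
      using False by (auto simp: not_le)
    let ?J = "J - {p}"
    have cJ: "card J = Suc (card ?J)"
      using fin p(1) by (rule card.remove)
    have "(\<Sum>i\<in>J. (\<Sum>j\<in>J. r i j) + h i)
        = (\<Sum>j\<in>J. r p j) + h p + (\<Sum>i\<in>?J. (\<Sum>j\<in>J. r i j) + h i)"
      by (rule sum.remove[OF fin p(1)])
    also have "(\<Sum>i\<in>?J. (\<Sum>j\<in>J. r i j) + h i)
        = (\<Sum>i\<in>?J. r i p) + (\<Sum>i\<in>?J. (\<Sum>j\<in>?J. r i j) + h i)"
      by (simp add: sum.remove[OF fin p(1)] sum.distrib)
    also have "(\<Sum>i\<in>?J. r i p) \<le> card ?J"
      using sum_mono[of ?J "\<lambda>i. r i p" "\<lambda>_. 1"] r by simp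
    \<comment> \<open>The left side drops by \<open>2 * N + 2 * card ?J + 1\<close>, more than twice
      the weight lost.\<close>
    finally have "2 * K * (K + u) + 2 * card ?J * N + (card ?J)\<^sup>2
        < 2 * (\<Sum>i\<in>?J. (\<Sum>j\<in>?J. r i j) + h i)"
      using p(2) less.prems(3) unfolding cJ by (simp add: power2_eq_square)
    then have "\<exists>I\<subseteq>?J. K \<le> card I \<and> (\<forall>i\<in>I. N \<le> (\<Sum>j\<in>I. r i j) + h i)"
      using fin less.prems(2) cJ by (intro less.hyps) auto
    then show ?thesis by blast
  qed blast
qed

section \<open>Edge counting and maximum matchings\<close>

lemma sum_adjacent_pairs:
  assumes "simple_graph V E"
  shows "(\<Sum>x\<in>V. \<Sum>y\<in>V. of_bool ({x, y} \<in> E)) = 2 * card E"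
proof -
  have finV: "finite V" and E: "\<And>e. e \<in> E \<Longrightarrow> e \<subseteq> V \<and> card e = 2"
    using assms by (auto simp: simple_graph_def)
  have finE: "finite E"
    using finV E finite_subset[of E "Pow V"] by auto
  have two: "card {(x, y). {x, y} = e} = 2" if "e \<in> E" for e
  proof -
    obtain x y where xy: "e = {x, y}" "x \<noteq> y" using E[OF \<open>e \<in> E\<close>] by (auto simp: card_2_iff)
    then have "{(x, y). {x, y} = e} = {(x, y), (y, x)}" by (auto simp: doubleton_eq_iff)
    then show ?thesis using xy by simp
  qed
  have "(\<Sum>x\<in>V. \<Sum>y\<in>V. of_bool ({x, y} \<in> E)) = (\<Sum>(x, y)\<in>V \<times> V. of_bool ({x, y} \<in> E) :: nat)"
    by (simp add: sum.cartesian_product)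
  also have "\<dots> = (\<Sum>(x, y)\<in>V \<times> V. if {x, y} \<in> E then 1 else 0)"
    by (intro sum.cong) auto
  also have "\<dots> = card {p \<in> V \<times> V. {fst p, snd p} \<in> E}"
    using finV by (subst card_eq_sum, subst sum.inter_filter) (auto simp: case_prod_unfold)
  also have "{p \<in> V \<times> V. {fst p, snd p} \<in> E} = (\<Union>e\<in>E. {(x, y). {x, y} = e})"
    using E by fastforce
  also have "card \<dots> = (\<Sum>e\<in>E. card {(x, y). {x, y} = e})"
  proof (rule card_UN_disjoint)
    \<comment> \<open>Finiteness follows from \<open>two\<close>, since an infinite set has
      cardinality 0.\<close>
    show "\<forall>e\<in>E. finite {(x, y). {x, y} = e}"
      using two card.infinite by force
  qed (use finE in auto)
  finally show ?thesis using two by simp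
qed

lemma maximum_matching_exists:
  assumes "finite E"
  obtains M where "maximum_matching E M"
proof -
  have "finite {M. matching E M}"
    using assms finite_subset[of _ "Pow E"] by (auto simp: matching_def)
  moreover have "{} \<in> {M. matching E M}" by (simp add: matching_def)
  ultimately have "matching_number E \<in> card ` {M. matching E M}"
    unfolding matching_number_def by (intro Max_in) auto
  then show thesis using that by (auto simp: maximum_matching_def)
qed

lemma card_matching_le:
  assumes "finite E" "matching E M"
  shows "card M \<le> matching_number E"
proof -
  have "finite {M. matching E M}"
    using assms finite_subset[of _ "Pow E"] by (auto simp: matching_def)
  then show ?thesis using assms unfolding matching_number_def by (intro Max_ge) auto
qed

text \<open>An edge with both ends unmatched could be added to \<open>M\<close>, contradicting
  maximality.\<close>

lemma unmatched_independent:
  assumes "finite E" "maximum_matching E M" "{x, y} \<in> E" "x \<notin> \<Union>M"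
  shows "y \<in> \<Union>M"
proof (rule ccontr)
  assume y: "y \<notin> \<Union>M"
  have M: "matching E M" "card M = matching_number E"
    using assms(2) by (auto simp: maximum_matching_def)
  have "finite M" using M(1) assms(1) finite_subset by (auto simp: matching_def)
  have "matching E (insert {x, y} M)"
    using M(1) assms(3,4) y by (auto simp: matching_def pairwise_insert disjnt_def)
  then have "card (insert {x, y} M) \<le> card M"
    using card_matching_le[OF assms(1)] M(2) by metis
  moreover have "{x, y} \<notin> M" using y by blast
  ultimately show False using \<open>finite M\<close> by simp
qed

lemma sum_Union_matching:
  fixes f :: "'a \<Rightarrow> nat"
  assumes "finite M" "pairwise disjnt M"
    and "\<And>e. e \<in> M \<Longrightarrow> e = {s e, t e} \<and> s e \<noteq> t e"
  shows "sum f (\<Union>M) = (\<Sum>e\<in>M. f (s e) + f (t e))"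
proof -
  have "sum f (\<Union>M) = (\<Sum>e\<in>M. sum f e)"
  proof (subst sum.Union_disjoint)
    show "\<forall>e\<in>M. finite e" using assms(3) by (metis finite.emptyI finite.insertI)
    show "\<forall>e\<in>M. \<forall>e'\<in>M. e \<noteq> e' \<longrightarrow> e \<inter> e' = {}"
      using assms(2) by (auto simp: pairwise_def disjnt_def)
  qed (simp add: assms)
  also have "\<dots> = (\<Sum>e\<in>M. f (s e) + f (t e))"
  proof (rule sum.cong)
    fix e assume "e \<in> M"
    then have e: "e = {s e, t e}" "s e \<noteq> t e" using assms(3) by blast+
    have "sum f {s e, t e} = f (s e) + f (t e)" using e(2) by simp
    then show "sum f e = f (s e) + f (t e)" by (simp flip: e(1))
  qed simp
  finally show ?thesis .
qed

text \<open>A transversal \<open>f\<close> re-matches the a-ends of \<open>I\<close>: each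
  \<open>e\<close> in \<open>I\<close> is replaced by the edge from \<open>a e\<close> to
  \<open>f e\<close>, and the rest of \<open>M\<close> stays. The result has the size of
  \<open>M\<close>, and \<open>f\<close> can be recovered from it.\<close>

lemma card_transversals_le_matchings:
  assumes "finite E" "maximum_matching E M" "I \<subseteq> M"
    and ab: "\<And>e. e \<in> M \<Longrightarrow> e = {a e, b e} \<and> a e \<noteq> b e"
    and S: "\<And>e. e \<in> I \<Longrightarrow> S e \<subseteq> {w \<in> b ` I \<union> - \<Union>M. {a e, w} \<in> E}"
  shows "card (transversals I S) \<le> card {M. maximum_matching E M}"
proof -
  have M: "M \<subseteq> E" "pairwise disjnt M" "card M = matching_number E"
    using assms(2) by (auto simp: maximum_matching_def matching_def)
  have finM: "finite M" using M(1) assms(1) finite_subset by blast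
  have uniq: "e = e'" if "e \<in> M" "e' \<in> M" "v \<in> e" "v \<in> e'" for e e' v
    using M(2) that by (auto simp: pairwise_def disjnt_def)
  have a: "a e \<in> e" and b: "b e \<in> e" if "e \<in> M" for e
    using ab[OF that] by (metis insertCI)+
  \<comment> \<open>\<open>e\<close> is the only edge of \<open>M\<close> through
    \<open>a e\<close>, and its b-end is the other vertex.\<close>
  have a_nb: "a e \<notin> b ` I \<union> - \<Union>M" if "e \<in> I" for e
  proof
    assume "a e \<in> b ` I \<union> - \<Union>M"
    moreover have "a e \<in> \<Union>M" using that assms(3) a by blast
    ultimately obtain e' where "e' \<in> I" "a e = b e'" by blast
    then have "e = e'" using uniq[of e e' "a e"] that assms(3) a b by (metis subsetD)
    then show False using ab \<open>a e = b e'\<close> that assms(3) by blast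
  qed
  define swap where "swap f = (M - I) \<union> (\<lambda>e. {a e, f e}) ` I" for f
  \<comment> \<open>The kept edges miss every vertex that a new edge can use.\<close>
  have notin: "v \<notin> e'" if "e' \<in> M - I" "v \<in> a ` I \<union> b ` I \<union> - \<Union>M" for v e'
    using that assms(3) uniq a b by blast
  \<comment> \<open>An a-end is never a target, so exactly one edge of \<open>swap f\<close> passes
    through \<open>a e\<close>, and it reveals \<open>f e\<close>. This serves both disjointness and
    injectivity of \<open>swap\<close>.\<close>
  have eq_of_a: "{a e, f e} = d" if "e \<in> I" "f \<in> transversals I S" "d \<in> swap f" "a e \<in> d" for e f d
  proof -
    have "d \<notin> M - I" using notin[of d "a e"] that by blast
    then obtain e' where e': "e' \<in> I" "d = {a e', f e'}" using \<open>d \<in> swap f\<close> by (auto simp: swap_def)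
    have "f e' \<in> b ` I \<union> - \<Union>M" using that(2) e'(1) S by (auto simp: transversals_def)
    then have "a e \<noteq> f e'" using a_nb[OF that(1)] by metis
    then have "a e = a e'" using that(4) e'(2) by simp
    then have "e = e'" using uniq[of e e' "a e"] that(1) e'(1) assms(3) a by (metis subsetD)
    then show ?thesis using e' by simp
  qed
  have "swap f \<in> {M. maximum_matching E M}" if f: "f \<in> transversals I S" for f
  proof -
    have fS: "f e \<in> b ` I \<union> - \<Union>M" "{a e, f e} \<in> E" if "e \<in> I" for e
      using f that S by (auto simp: transversals_def)
    have disj: "disjnt {a e, f e} d" if "e \<in> I" "d \<in> swap f" "d \<noteq> {a e, f e}" for e d
    proof -
      have "a e \<notin> d" using eq_of_a f that by blast
      moreover have "f e \<notin> d"
      proof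
        assume fed: "f e \<in> d"
        then have "d \<notin> M - I" using notin[of d "f e"] fS(1)[OF that(1)] by blast
        then obtain e' where e': "e' \<in> I" "d = {a e', f e'}" using \<open>d \<in> swap f\<close> by (auto simp: swap_def)
        have "f e \<noteq> a e'" using a_nb[OF e'(1)] fS(1)[OF that(1)] by metis
        then have "f e = f e'" using fed e' by auto
        then have "e = e'" using f that(1) e'(1) by (auto simp: transversals_def dest: inj_onD)
        then show False using e' that by simp
      qed
      ultimately show ?thesis by (simp add: disjnt_def)
    qed
    have "pairwise disjnt (swap f)"
    proof (rule pairwiseI)
      fix d d' assume d: "d \<in> swap f" "d' \<in> swap f" "d \<noteq> d'"
      show "disjnt d d'"
      proof (cases "d \<in> M - I \<and> d' \<in> M - I")
        case True
        then show ?thesis using M(2) d(3) by (auto simp: pairwise_def)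
      next
        case False
        then consider e where "e \<in> I" "d = {a e, f e}" | e where "e \<in> I" "d' = {a e, f e}"
          using d by (auto simp: swap_def)
        then show ?thesis using disj d by cases (metis disjnt_sym)+
      qed
    qed
    moreover have "swap f \<subseteq> E"
      using M(1) fS(2) by (auto simp: swap_def)
    moreover have "card (swap f) = card M"
    proof -
      have "inj_on (\<lambda>e. {a e, f e}) I"
      proof (rule inj_onI)
        fix e e' assume e: "e \<in> I" "e' \<in> I" "{a e, f e} = {a e', f e'}"
        then have "a e = a e'" using a_nb[OF e(1)] fS(1)[OF e(2)] by (metis doubleton_eq_iff)
        then show "e = e'" using uniq[of e e' "a e"] e assms(3) a by (metis subsetD)
      qed
      moreover have "(M - I) \<inter> (\<lambda>e. {a e, f e}) ` I = {}"
        using notin by blast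
      ultimately have "card (swap f) = card (M - I) + card I"
        using finM assms(3) finite_subset[OF assms(3) finM]
        by (simp add: swap_def card_Un_disjoint card_image)
      also have "\<dots> = card M"
        using finM assms(3) by (metis card_Diff_subset card_mono finite_subset le_add_diff_inverse2)
      finally show ?thesis .
    qed
    ultimately show ?thesis using M(3) by (simp add: maximum_matching_def matching_def)
  qed
  moreover have "inj_on swap (transversals I S)"
  proof (rule inj_onI)
    fix f g assume f: "f \<in> transversals I S" and g: "g \<in> transversals I S" and eq: "swap f = swap g"
    show "f = g"
    proof
      fix e
      show "f e = g e"
      proof (cases "e \<in> I")
        case True
        have "{a e, f e} \<in> swap g" using True eq[symmetric] by (auto simp: swap_def)
        then have "{a e, g e} = {a e, f e}" using eq_of_a[of e g] True g by blast
        then show ?thesis by (metis doubleton_eq_iff)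
      next
        case False
        then show ?thesis using f g by (auto simp: transversals_def PiE_iff extensional_def)
      qed
    qed
  qed
  moreover have "finite {M. maximum_matching E M}"
    using assms(1) finite_subset[of _ "Pow E"] by (auto simp: maximum_matching_def matching_def)
  ultimately show ?thesis by (intro card_inj_on_le) auto
qed

section \<open>Counting maximum matchings under an edge-density condition\<close>

text \<open>The orientation makes twice the oriented weight at least \<open>card E\<close>, so
  \<open>dense\<close> becomes the hypothesis of \<open>exists_dense_core\<close> for
  \<open>M\<close>, with \<open>u\<close> the number of unmatched vertices. Transversals over the
  core then yield the matchings.\<close>

theorem card_maximum_matchings_ge:
  assumes G: "simple_graph V E"
    and k: "k = matching_number E"
    and KN: "K \<le> N"
    and dense: "2 * K * (K + (card V - 2 * k)) + 2 * k * N + k\<^sup>2 < card E"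
  shows "falling_factorial N K \<le> card {M. maximum_matching E M}"
proof -
  have finV: "finite V" and E: "\<And>e. e \<in> E \<Longrightarrow> e \<subseteq> V \<and> card e = 2"
    using G by (auto simp: simple_graph_def)
  have finE: "finite E"
    using finV E finite_subset[of E "Pow V"] by auto
  obtain M where max: "maximum_matching E M" using maximum_matching_exists[OF finE] .
  then have M: "M \<subseteq> E" "pairwise disjnt M" "card M = k"
    by (auto simp: maximum_matching_def matching_def k)
  have finM: "finite M" using M(1) finE finite_subset by blast
  have "\<exists>s t. e = {s, t} \<and> s \<noteq> t" if "e \<in> M" for e
    using E[of e] M(1) that by (auto simp: card_2_iff)
  then obtain s t where st: "e = {s e, t e} \<and> s e \<noteq> t e" if "e \<in> M" for e by metis
  define U where "U = V - \<Union>M"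
  define q :: "'a \<Rightarrow> 'a \<Rightarrow> nat" where "q x y = of_bool ({x, y} \<in> E)" for x y
  define h where "h x = (\<Sum>w\<in>U. q x w)" for x
  have qsym: "q x y = q y x" for x y by (simp add: q_def insert_commute)
  have qirr: "q x x = 0" for x using E[of "{x}"] by (auto simp: q_def)
  have q1: "q x y \<le> 1" for x y by (simp add: q_def)
  have UM: "\<Union>M \<subseteq> V" using M(1) E by blast
  have sum_UM: "sum f (\<Union>M) = (\<Sum>e\<in>M. f (s e) + f (t e))" for f :: "'a \<Rightarrow> nat"
    using st by (intro sum_Union_matching[OF finM M(2)]) blast
  have cardUM: "card (\<Union>M) = 2 * k"
    using sum_UM[of "\<lambda>_. 1"] M(3) by simp
  have cardU: "card U = card V - 2 * k"
    unfolding U_def using UM finV finite_subset cardUM by (subst card_Diff_subset) auto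
  obtain a b where ab: "\<forall>e\<in>M. (a e = s e \<and> b e = t e) \<or> (a e = t e \<and> b e = s e)"
    and le: "(\<Sum>i\<in>M. \<Sum>j\<in>M. q (s i) (s j) + q (s i) (t j) + q (t i) (s j) + q (t i) (t j))
      + 2 * (\<Sum>i\<in>M. h (s i) + h (t i)) \<le> 4 * (\<Sum>i\<in>M. (\<Sum>j\<in>M. q (a i) (b j)) + h (a i))"
    using exists_orientation[where q = q and s = s and t = t and h = h, OF finM qsym qirr] by blast
  have V: "sum f V = sum f (\<Union>M) + sum f U" for f :: "'a \<Rightarrow> nat"
    using sum.subset_diff[OF UM finV, of f] by (simp add: U_def add.commute)
  have "q x y = 0" if "x \<in> U" "y \<in> U" for x y
    using unmatched_independent[OF finE max, of x y] that by (auto simp: q_def U_def)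
  then have UU: "(\<Sum>x\<in>U. \<Sum>y\<in>U. q x y) = 0" by simp
  have "2 * card E = (\<Sum>x\<in>V. \<Sum>y\<in>V. q x y)"
    unfolding q_def using sum_adjacent_pairs[OF G] by simp
  \<comment> \<open>No edge lies inside \<open>U\<close>, and an edge between \<open>U\<close> and
    the matched vertices is seen from both sides.\<close>
  also have "\<dots> = (\<Sum>x\<in>\<Union>M. \<Sum>y\<in>\<Union>M. q x y) + 2 * (\<Sum>x\<in>\<Union>M. h x)"
    using UU sum.swap[of q U "\<Union>M"] unfolding V h_def
    by (simp add: sum.distrib qsym[of _ "_ :: 'a"])
  also have "\<dots> = (\<Sum>i\<in>M. \<Sum>j\<in>M. q (s i) (s j) + q (s i) (t j) + q (t i) (s j) + q (t i) (t j))
      + 2 * (\<Sum>i\<in>M. h (s i) + h (t i))"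
    unfolding sum_UM by (simp add: sum.distrib)
  also note le
  finally have large: "2 * K * (K + card U) + 2 * card M * N + (card M)\<^sup>2
      < 2 * (\<Sum>i\<in>M. (\<Sum>j\<in>M. q (a i) (b j)) + h (a i))"
    using dense by (simp add: M(3) cardU)
  have hU: "h x \<le> card U" for x
    using sum_mono[of U "q x" "\<lambda>_. 1"] by (simp add: h_def q_def)
  have "\<exists>I\<subseteq>M. K \<le> card I \<and> (\<forall>i\<in>I. N \<le> (\<Sum>j\<in>I. q (a i) (b j)) + h (a i))"
    using finM q1 hU large by (rule exists_dense_core)
  then obtain I where I: "I \<subseteq> M" "K \<le> card I"
    and core: "\<forall>i\<in>I. N \<le> (\<Sum>j\<in>I. q (a i) (b j)) + h (a i)"
    by blast
  have ab': "e = {a e, b e} \<and> a e \<noteq> b e" if "e \<in> M" for e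
    using st[OF that] ab that by (metis insert_commute)
  have finI: "finite I" using I(1) finM finite_subset by blast
  have injb: "inj_on b M"
    using ab' M(2) by (intro inj_onI) (metis disjnt_insert1 insertCI insert_commute pairwiseD)
  \<comment> \<open>The admissible new partners of \<open>a e\<close>. Their number is the core
    weight of \<open>e\<close>, because \<open>b\<close> is injective and its values are matched
    vertices.\<close>
  define S where "S e = {w \<in> b ` I \<union> U. {a e, w} \<in> E}" for e
  have finU: "finite U" using finV by (simp add: U_def)
  have bIU: "b ` I \<inter> U = {}"
    using ab' I(1) by (fastforce simp: U_def)
  have cardS: "card (S e) = (\<Sum>j\<in>I. q (a e) (b j)) + h (a e)" for e
  proof -
    have "card (S e) = (\<Sum>w\<in>b ` I \<union> U. q (a e) w)"
      using finI finU by (simp add: S_def q_def of_bool_def sum.If_cases Int_def)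
    also have "\<dots> = (\<Sum>w\<in>b ` I. q (a e) w) + h (a e)"
      unfolding h_def using finI finU bIU by (intro sum.union_disjoint) auto
    also have "(\<Sum>w\<in>b ` I. q (a e) w) = (\<Sum>j\<in>I. q (a e) (b j))"
      using inj_on_subset[OF injb I(1)] by (simp add: sum.reindex)
    finally show ?thesis .
  qed
  have "falling_factorial N K \<le> falling_factorial N (min N (card I))"
    using KN I(2) by (intro falling_factorial_mono) auto
  also have "\<dots> \<le> card (transversals I S)"
  proof (rule card_transversals_ge)
    fix Y assume Y: "Y \<subseteq> I"
    \<comment> \<open>The old partner stays admissible, so \<open>b\<close> itself is a system of
      distinct representatives and Hall's condition holds.\<close>
    have "b e \<in> S e" if "e \<in> Y" for e
      using that Y I(1) M(1) ab' by (force simp: S_def)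
    then have "b ` Y \<subseteq> \<Union>(S ` Y)" by blast
    moreover have "finite (\<Union>(S ` Y))"
      using Y finI finU finite_subset[of Y I] by (auto simp: S_def)
    ultimately have "card (b ` Y) \<le> card (\<Union>(S ` Y))" by (intro card_mono)
    then show "card Y \<le> card (\<Union>(S ` Y))"
      using Y I(1) injb by (metis card_image inj_on_subset subset_trans)
  qed (use finI finU core cardS in \<open>auto simp: S_def\<close>)
  also have "\<dots> \<le> card {M. maximum_matching E M}"
    using ab' I(1) by (intro card_transversals_le_matchings[OF finE max, of I a b]) (auto simp: S_def U_def)
  finally show ?thesis .
qed

section \<open>Comparison with the Erdos-Gallai bound\<close>

theorem theorem1:
  fixes V :: "'a set" and E :: "'a set set" and \<nu> :: real and n m :: nat
  assumes "0 < \<nu>" and "\<nu> \<le> 1/2"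
    and "simple_graph V E"
    and "card V = n" and "card E = m"
    and "real (matching_number E) = \<nu> * real n"
    and "(\<nu> / 50)\<^sup>2 * real n \<ge> 1"
    and "real m \<ge> erdos_gallai_bound n \<nu> - (\<nu> / 50)\<^sup>2 * (real n)\<^sup>2"
  shows "card {M. maximum_matching E M} \<ge>
    falling_factorial (nat \<lceil>0.1 * real n\<rceil>) (nat \<lceil>0.1 * \<nu> * real n\<rceil>)"
proof -
  define k where "k = matching_number E"
  define N where "N = nat \<lceil>0.1 * real n\<rceil>"
  define K where "K = nat \<lceil>0.1 * \<nu> * real n\<rceil>"
  have kn: "real k = \<nu> * real n" using assms(6) by (simp add: k_def)
  have n: "0 < n" using assms(7) by (cases n) auto
  have k2n: "2 * real k \<le> real n" using assms(2) n by (simp add: kn)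
  then have nk: "real (n - 2 * k) = real n - 2 * real k" by linarith
  \<comment> \<open>Rescaled, the size hypothesis says that \<open>n\<close> is at most
    \<open>k\<^sup>2 / 2500\<close>; this absorbs all linear terms, including those from rounding up
    in \<open>N\<close> and \<open>K\<close>.\<close>
  have "real n * 1 \<le> real n * ((\<nu> / 50)\<^sup>2 * real n)"
    using assms(7) by (intro mult_left_mono) auto
  also have "\<dots> = (real k)\<^sup>2 / 2500" by (simp add: kn power2_eq_square)
  finally have big: "2500 * real n \<le> (real k)\<^sup>2" by simp
  have N: "real N \<le> real n / 10 + 1"
    unfolding N_def by linarith
  have K: "real K \<le> real k / 10 + 1"
    unfolding K_def kn using kn[symmetric] by linarith
  have KN: "K \<le> N"
    unfolding K_def N_def using assms(1,2) n by (intro nat_mono ceiling_mono) auto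
  have m: "erdos_gallai_bound n \<nu> - (real k)\<^sup>2 / 2500 \<le> real m"
    using assms(8) by (simp add: kn power_mult_distrib power_divide)
  have choose2: "(x :: real) gchoose 2 = x * (x - 1) / 2" for x
    by (simp add: gbinomial_prod_rev numeral_2_eq_2)
  have thr: "(2/5 - 3 / (5 * real n)) * real n = 2/5 * real n - 3/5"
    using n by (simp add: left_diff_distrib)
  \<comment> \<open>The quadratic part of the resulting upper bound is 0.4 k n + 0.62 k^2.\<close>
  have "2 * real K * (real K + (real n - 2 * real k)) + 2 * real k * real N + (real k)\<^sup>2
     \<le> 2 * (real k / 10 + 1) * ((real k / 10 + 1) + (real n - 2 * real k))
      + 2 * real k * (real n / 10 + 1) + (real k)\<^sup>2"
    using K N k2n by (intro add_mono mult_mono) auto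
  also have "\<dots> < erdos_gallai_bound n \<nu> - (real k)\<^sup>2 / 2500"
  proof (cases "\<nu> \<le> 2/5 - 3 / (5 * real n)")
    case True
    then have "\<nu> * real n \<le> (2/5 - 3 / (5 * real n)) * real n"
      by (intro mult_right_mono) auto
    then have "real k \<le> 2/5 * real n"
      unfolding thr kn[symmetric] by linarith
    \<comment> \<open>The quadratic part of the right side is k n - 0.5004 k^2. As k^2 is at most
      0.4 k n, the gap is at least 0.15 k n.\<close>
    then have "(real k)\<^sup>2 \<le> 2/5 * (real k * real n)"
      using mult_left_mono[of "real k" "2/5 * real n" "real k"] by (simp add: power2_eq_square)
    moreover have "erdos_gallai_bound n \<nu> = real k * (real n - real k) + real k * (real k - 1) / 2"
      using True by (simp add: erdos_gallai_bound_def choose2 kn)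
    ultimately show ?thesis
      using big n k2n by (simp add: power2_eq_square field_simps)
  next
    case False
    then have "(2/5 - 3 / (5 * real n)) * real n \<le> \<nu> * real n"
      by (intro mult_right_mono) auto
    then have "2 * real n \<le> 5 * real k + 3"
      unfolding thr kn[symmetric] by linarith
    \<comment> \<open>Now 0.4 k n is at most k^2 + 0.6 k, so up to linear terms 1.62 k^2 is compared
      with 1.9996 k^2.\<close>
    then have "2 * (real k * real n) \<le> 5 * (real k)\<^sup>2 + 3 * real k"
      using mult_left_mono[of "2 * real n" "5 * real k + 3" "real k"]
      by (simp add: power2_eq_square algebra_simps)
    moreover have "erdos_gallai_bound n \<nu> = (2 * real k + 1) * (2 * real k) / 2"
      using False by (simp add: erdos_gallai_bound_def choose2 kn)
    ultimately show ?thesis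
      using big n k2n by (simp add: power2_eq_square field_simps)
  qed
  also note m
  finally have "real (2 * K * (K + (n - 2 * k)) + 2 * k * N + k\<^sup>2) < real m"
    by (simp add: nk add_diff_eq)
  then have "2 * K * (K + (card V - 2 * k)) + 2 * k * N + k\<^sup>2 < card E"
    unfolding assms(4,5) by (simp only: of_nat_less_iff)
  then show ?thesis
    using card_maximum_matchings_ge[OF assms(3) k_def KN] by (simp add: N_def K_def)
qed

end
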